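(* Let $\Gamma:\ell_\infty^+\to\ell_\infty^+$ be a well-defined and continuous gain operator built from gains $\gamma_{ij}$ and monotone aggregation functions $\mu_i$, satisfying the following assumptions: (i) The family $\{\gamma_{ij}: i,j\in\mathbb{N}\}$ is pointwise equicontinuous. (ii) $\Gamma$ satisfies the $\oplus$-MBI property. (iii) There exists $\omega\in\mathcal{K}_\infty$ with $\omega<\mathrm{id}$ such that the system $s(k+1)=\Gamma_\omega(s(k))$ induced by $\Gamma_\omega=\omega^{-1}\circ\Gamma$ is UGAS. (iv) For all $0<R_1<R_2$ there exists $l>0$ such that the MAFs $\mu_i$, $i\in\mathbb{N}$, satisfy $$\mu_i(s^2)-\mu_i(s^1)\ \ge\ l\,(s^2_j-s^1_j)$$ whenever $j\in I_i$ and $R_1\mathbb{1}\le s^1\le s^2\le R_2\mathbb{1}$. (v) For every compact interval $J\subset(0,\infty)$ there exists $c>0$ such that $|\gamma_{ij}(r_1)-\gamma_{ij}(r_2)|\ge c|r_1-r_2|$ for all $i\in\mathbb{N}$, $j\in I_i$ and $r_1,r_2\in J$. Then every single-valued selection $\sigma:\mathbb{R}_+\to\ell_\infty^+$ of the set-valued mapping $r\mapsto\mathrm{Fix}(\Gamma_r)$ (that is, $\sigma(r)\in\mathrm{Fix}(\Gamma_r)$ for all $r\ge0$) is a path of decay for $\Gamma$, provided that $\sigma$ is locally Lipschitz continuous on $(0,\infty)$.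
   Context: $\mathbb{N}=\{1,2,\dots\}$, $\mathbb{R}_+=[0,\infty)$. $\ell_\infty$ is the Banach space of bounded real sequences with sup norm $\|\cdot\|_\infty$; $\ell_\infty^+$ is the cone of nonnegative sequences; $\le$ is the componentwise order; $\oplus$ is the componentwise maximum; $\mathbb{1}$ is the sequence with all components $1$. For $I\subseteq\mathbb{N}$, $\ell_\infty^+(I)=\{s\in\ell_\infty^+: s_i=0\ \forall i\notin I\}$. $\mathcal{K}$: continuous strictly increasing $\gamma:\mathbb{R}_+\to\mathbb{R}_+$ with $\gamma(0)=0$. $\mathcal{K}_\infty$: unbounded elements of $\mathcal{K}$. $\mathcal{KL}$: continuous $\beta:\mathbb{R}_+^2\to\mathbb{R}_+$ with $\beta(\cdot,t)\in\mathcal{K}$ for all $t\ge0$ and, for all $r>0$, $\beta(r,\cdot)$ strictly decreasing with limit $0$ at infinity. $\omega<\mathrm{id}$ means $\omega(r)<r$ for all $r>0$. Scalar functions such as $\omega^{-1}$ are applied to sequences componentwise. A monotone aggregation function (MAF) is $\mu:\ell_\infty^+\to[0,\infty]$ with $\mu(0)=0$; $s^1\le s^2\Rightarrow\mu(s^1)\le\mu(s^2)$; and $\mu$ finite-valued and continuous on $\ell_\infty^+(I)$ for every finite $I\subset\mathbb{N}$. Gain operator: for each $i\in\mathbb{N}$ one is given a finite set $I_i\subset\mathbb{N}\setminus\{i\}$, functions $\gamma_{ij}\in\mathcal{K}\cup\{0\}$ ($j\in\mathbb{N}$) with $\gamma_{ij}=0$ for $j\notin I_i$, and a MAF $\mu_i$.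 Then $\Gamma(s)=(\mu_i([\gamma_{ij}(s_j)]_{j\in\mathbb{N}}))_{i\in\mathbb{N}}$. "Well-defined and continuous" means that $\Gamma$ maps $\ell_\infty^+$ into itself and is norm-continuous. $\Gamma$ satisfies the $\oplus$-MBI property if there is $\varphi\in\mathcal{K}_\infty$ such that for all $s,b\in\ell_\infty^+$: $s\le\Gamma(s)\oplus b\Rightarrow\|s\|_\infty\le\varphi(\|b\|_\infty)$. The system $s(k+1)=T(s(k))$ for a monotone $T:\ell_\infty^+\to\ell_\infty^+$ is UGAS if there is $\beta\in\mathcal{KL}$ with $\|T^k(s)\|_\infty\le\beta(\|s\|_\infty,k)$ for all $s\in\ell_\infty^+$, $k\ge0$. For $r\ge0$, $\Gamma_r(s):=r\mathbb{1}\oplus\Gamma(s)$, and $\mathrm{Fix}(\Gamma_r)$ is its set of fixed points in $\ell_\infty^+$. A path of decay for $\Gamma$ is a mapping $\sigma:\mathbb{R}_+\to\ell_\infty^+$, with components $\sigma_i$, such that: (P1) $\Gamma(\sigma(r))\le\sigma(r)$ for all $r\ge0$; (P2) there are $\sigma_{\min},\sigma_{\max}\in\mathcal{K}_\infty$ with $\sigma_{\min}\le\sigma_i\le\sigma_{\max}$ for all $i$; (P3) each $\sigma_i\in\mathcal{K}_\infty$; (P4) for every compact interval $J\subset(0,\infty)$ there are $0<c\le C<\infty$ with $c|r_1-r_2|\le|\sigma_i^{-1}(r_1)-\sigma_i^{-1}(r_2)|\le C|r_1-r_2|$ for all $r_1,r_2\in J$, $i\in\mathbb{N}$.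
   Formalization: In (iv), μ_i is evaluated at the restrictions of s^1 and s^2 to I_i (components outside I_i set to 0), since at the full sequences μ_i may be infinite and the claim fails; for μ_i depending only on the components in I_i this is (iv) verbatim. *)

theory Defs
  imports "HOL-Analysis.Analysis"
begin

(* l_infinity: the topology on nat is discrete, so these are all bounded real sequences, and the
   norm is the sup norm. The index set is relabelled from {1,2,...} to {0,1,...}. *)
type_synonym rseq = "nat \<Rightarrow>\<^sub>C real"

lemma Bcontfun_seq: "bounded (range f) \<Longrightarrow> apply_bcontfun (Bcontfun f) = f" for f :: "nat \<Rightarrow> real"
  by (rule Bcontfun_inverse) (simp add: bcontfun_def)

definition ell_inf_pos :: "rseq set" where
  "ell_inf_pos = {s :: rseq. \<forall>i. 0 \<le> s i}"

definition ell_inf_pos_on :: "nat set \<Rightarrow> rseq set" where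
  "ell_inf_pos_on J = {s \<in> ell_inf_pos. \<forall>i. i \<notin> J \<longrightarrow> s i = 0}"

definition seq_le :: "rseq \<Rightarrow> rseq \<Rightarrow> bool" (infix "\<preceq>" 50) where
  "s \<preceq> t \<longleftrightarrow> (\<forall>i. s i \<le> t i)"

definition seq_max :: "rseq \<Rightarrow> rseq \<Rightarrow> rseq" (infixl "\<oplus>" 65) where
  "s \<oplus> t = Bcontfun (\<lambda>i. max (s i) (t i))"

definition restrict_seq :: "nat set \<Rightarrow> rseq \<Rightarrow> rseq" where
  "restrict_seq J s = Bcontfun (\<lambda>i. if i \<in> J then s i else 0)"

(* Functions on [0,\<infinity>) are encoded as functions on the reals of which only the values on {0..}
   matter. Members of class_K map {0..} into {0..} by monotonicity and f 0 = 0. *)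
definition class_K :: "(real \<Rightarrow> real) set" where
  "class_K = {f. continuous_on {0..} f \<and> strict_mono_on {0..} f \<and> f 0 = 0}"

definition class_K_inf :: "(real \<Rightarrow> real) set" where
  "class_K_inf = {f \<in> class_K. \<not> bdd_above (f ` {0..})}"

definition class_KL :: "(real \<Rightarrow> real \<Rightarrow> real) set" where
  "class_KL = {\<beta>. continuous_on ({0..} \<times> {0..}) (\<lambda>(r, t). \<beta> r t) \<and>
     (\<forall>t\<ge>0. (\<lambda>r. \<beta> r t) \<in> class_K) \<and>
     (\<forall>r>0. strict_antimono_on {0..} (\<beta> r) \<and> (\<beta> r \<longlongrightarrow> 0) at_top)}"

definition inv_pos :: "(real \<Rightarrow> real) \<Rightarrow> real \<Rightarrow> real" where
  "inv_pos f = the_inv_into {0..} f"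

definition MAF :: "(rseq \<Rightarrow> ennreal) \<Rightarrow> bool" where
  "MAF \<mu> \<longleftrightarrow> \<mu> 0 = 0 \<and>
     (\<forall>s\<in>ell_inf_pos. \<forall>t\<in>ell_inf_pos. s \<preceq> t \<longrightarrow> \<mu> s \<le> \<mu> t) \<and>
     (\<forall>J. finite J \<longrightarrow>
        (\<forall>s\<in>ell_inf_pos_on J. \<mu> s < \<infinity>) \<and> continuous_on (ell_inf_pos_on J) \<mu>)"

definition gain_data ::
  "(nat \<Rightarrow> nat set) \<Rightarrow> (nat \<Rightarrow> nat \<Rightarrow> real \<Rightarrow> real) \<Rightarrow> (nat \<Rightarrow> rseq \<Rightarrow> ennreal) \<Rightarrow> bool" where
  "gain_data I \<gamma> \<mu> \<longleftrightarrow> (\<forall>i. finite (I i) \<and> i \<notin> I i \<and> MAF (\<mu> i) \<and>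
     (\<forall>j. \<gamma> i j \<in> class_K \<or> (\<forall>r\<ge>0. \<gamma> i j r = 0)) \<and>
     (\<forall>j. j \<notin> I i \<longrightarrow> (\<forall>r\<ge>0. \<gamma> i j r = 0)))"

definition gain_vec :: "(nat \<Rightarrow> nat \<Rightarrow> real \<Rightarrow> real) \<Rightarrow> rseq \<Rightarrow> nat \<Rightarrow> rseq" where
  "gain_vec \<gamma> s i = Bcontfun (\<lambda>j. \<gamma> i j (s j))"

(* The use of Bcontfun and enn2real is meaningful under gain_well_defined. *)
definition gain_op ::
  "(nat \<Rightarrow> nat \<Rightarrow> real \<Rightarrow> real) \<Rightarrow> (nat \<Rightarrow> rseq \<Rightarrow> ennreal) \<Rightarrow> rseq \<Rightarrow> rseq" where
  "gain_op \<gamma> \<mu> s = Bcontfun (\<lambda>i. enn2real (\<mu> i (gain_vec \<gamma> s i)))"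

definition gain_well_defined ::
  "(nat \<Rightarrow> nat \<Rightarrow> real \<Rightarrow> real) \<Rightarrow> (nat \<Rightarrow> rseq \<Rightarrow> ennreal) \<Rightarrow> bool" where
  "gain_well_defined \<gamma> \<mu> \<longleftrightarrow>
     (\<forall>s\<in>ell_inf_pos. \<exists>t\<in>ell_inf_pos. \<forall>i. \<mu> i (gain_vec \<gamma> s i) = ennreal (t i))"

lemma seq_max_apply [simp]: "(s \<oplus> t) i = max (s i) (t i)"
proof -
  have "max (s i) (t i) \<le> norm s + norm t" "- (norm s + norm t) \<le> max (s i) (t i)" for i
    using norm_bounded[of s i] norm_bounded[of t i] by (auto simp: max_def)
  hence "bounded (range (\<lambda>i. max (s i) (t i)))"
    by (intro boundedI[where B = "norm s + norm t"]) (auto simp: abs_le_iff, smt (verit))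
  thus ?thesis
    by (simp add: seq_max_def Bcontfun_seq)
qed

lemma restrict_seq_apply [simp]: "restrict_seq J s i = (if i \<in> J then s i else 0)"
proof -
  have "bounded (range (\<lambda>i. if i \<in> J then s i else 0))"
    by (rule boundedI[where B = "norm s"]) (use norm_bounded[of s] in auto)
  thus ?thesis
    by (simp add: restrict_seq_def Bcontfun_seq)
qed

lemma gain_vec_apply:
  assumes "gain_data I \<gamma> \<mu>" "s \<in> ell_inf_pos"
  shows "gain_vec \<gamma> s i j = \<gamma> i j (s j)"
proof -
  have "range (\<lambda>j. \<gamma> i j (s j)) \<subseteq> insert 0 ((\<lambda>j. \<gamma> i j (s j)) ` I i)"
  proof (rule image_subsetI)
    fix j
    show "\<gamma> i j (s j) \<in> insert 0 ((\<lambda>j. \<gamma> i j (s j)) ` I i)"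
      using assms by (cases "j \<in> I i") (simp_all add: gain_data_def ell_inf_pos_def)
  qed
  moreover have "finite (insert 0 ((\<lambda>j. \<gamma> i j (s j)) ` I i))"
    using assms(1) by (simp add: gain_data_def)
  ultimately have "bounded (range (\<lambda>j. \<gamma> i j (s j)))"
    by (meson finite_imp_bounded finite_subset)
  thus ?thesis
    by (simp add: gain_vec_def Bcontfun_seq)
qed

lemma gain_op_apply:
  assumes "gain_well_defined \<gamma> \<mu>" "s \<in> ell_inf_pos"
  shows "ennreal (gain_op \<gamma> \<mu> s i) = \<mu> i (gain_vec \<gamma> s i)" and "gain_op \<gamma> \<mu> s \<in> ell_inf_pos"
proof -
  obtain t :: rseq where t: "t \<in> ell_inf_pos" "\<And>i. \<mu> i (gain_vec \<gamma> s i) = ennreal (t i)"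
    using assms unfolding gain_well_defined_def by blast
  have "(\<lambda>i. enn2real (\<mu> i (gain_vec \<gamma> s i))) = apply_bcontfun t"
    using t by (auto simp: ell_inf_pos_def)
  hence "gain_op \<gamma> \<mu> s = t"
    by (simp add: gain_op_def apply_bcontfun_inverse)
  with t show "ennreal (gain_op \<gamma> \<mu> s i) = \<mu> i (gain_vec \<gamma> s i)" "gain_op \<gamma> \<mu> s \<in> ell_inf_pos"
    by auto
qed

definition max_MBI :: "(rseq \<Rightarrow> rseq) \<Rightarrow> bool" where
  "max_MBI \<Gamma> \<longleftrightarrow> (\<exists>\<phi>\<in>class_K_inf. \<forall>s\<in>ell_inf_pos. \<forall>b\<in>ell_inf_pos.
     s \<preceq> \<Gamma> s \<oplus> b \<longrightarrow> norm s \<le> \<phi> (norm b))"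

definition UGAS :: "(rseq \<Rightarrow> rseq) \<Rightarrow> bool" where
  "UGAS T \<longleftrightarrow> (\<exists>\<beta>\<in>class_KL. \<forall>s\<in>ell_inf_pos. \<forall>k::nat. norm ((T ^^ k) s) \<le> \<beta> (norm s) (real k))"

definition comp_inv :: "(real \<Rightarrow> real) \<Rightarrow> (rseq \<Rightarrow> rseq) \<Rightarrow> rseq \<Rightarrow> rseq" where
  "comp_inv \<omega> \<Gamma> s = Bcontfun (\<lambda>i. inv_pos \<omega> (\<Gamma> s i))"

definition trunc_op :: "(rseq \<Rightarrow> rseq) \<Rightarrow> real \<Rightarrow> rseq \<Rightarrow> rseq" where
  "trunc_op \<Gamma> r s = const_bcontfun r \<oplus> \<Gamma> s"

definition Fix_pos :: "(rseq \<Rightarrow> rseq) \<Rightarrow> rseq set" where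
  "Fix_pos T = {s \<in> ell_inf_pos. T s = s}"

definition pointwise_equicontinuous_on :: "real set \<Rightarrow> (real \<Rightarrow> real) set \<Rightarrow> bool" where
  "pointwise_equicontinuous_on S F \<longleftrightarrow> (\<forall>x\<in>S. \<forall>e>0. \<exists>d>0. \<forall>f\<in>F. \<forall>y\<in>S.
     dist y x < d \<longrightarrow> dist (f y) (f x) < e)"

definition locally_Lipschitz_on ::
  "'a::metric_space set \<Rightarrow> ('a \<Rightarrow> 'b::metric_space) \<Rightarrow> bool" where
  "locally_Lipschitz_on S f \<longleftrightarrow> (\<forall>x\<in>S. \<exists>u>0. \<exists>L. L-lipschitz_on (cball x u \<inter> S) f)"

(* A MAF is only guaranteed to be finite on finitely supported sequences, so for sequences
   bounded below by R1 > 0 in all components the difference of two values of \<mu> i need not be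
   defined. Node i evaluates \<mu> i only on l_infinity^+(I i), hence \<mu> i is regarded here as a
   function of the components with index in I i. Without this reading the condition would not
   constrain the gain operator at all: adding to \<mu> i the functional "sum of s j over j in I i if
   inf s > 0, else 0" changes neither the gain operator nor the MAF property. *)
definition MAF_expansive ::
  "(nat \<Rightarrow> nat set) \<Rightarrow> (nat \<Rightarrow> rseq \<Rightarrow> ennreal) \<Rightarrow> bool" where
  "MAF_expansive I \<mu> \<longleftrightarrow> (\<forall>R1 R2. 0 < R1 \<and> R1 < R2 \<longrightarrow> (\<exists>l>0. \<forall>i. \<forall>j\<in>I i. \<forall>s1 s2.
     const_bcontfun R1 \<preceq> s1 \<and> s1 \<preceq> s2 \<and> s2 \<preceq> const_bcontfun R2 \<longrightarrow>
     enn2real (\<mu> i (restrict_seq (I i) s2)) - enn2real (\<mu> i (restrict_seq (I i) s1))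
       \<ge> l * (s2 j - s1 j)))"

definition path_of_decay :: "(rseq \<Rightarrow> rseq) \<Rightarrow> (real \<Rightarrow> rseq) \<Rightarrow> bool" where
  "path_of_decay \<Gamma> \<sigma> \<longleftrightarrow>
     (\<forall>r\<ge>0. \<sigma> r \<in> ell_inf_pos) \<and>
     (\<forall>r\<ge>0. \<Gamma> (\<sigma> r) \<preceq> \<sigma> r) \<and>
     (\<exists>\<sigma>min\<in>class_K_inf. \<exists>\<sigma>max\<in>class_K_inf. \<forall>i. \<forall>r\<ge>0. \<sigma>min r \<le> \<sigma> r i \<and> \<sigma> r i \<le> \<sigma>max r) \<and>
     (\<forall>i. (\<lambda>r. \<sigma> r i) \<in> class_K_inf) \<and>
     (\<forall>a b. 0 < a \<and> a \<le> b \<longrightarrow> (\<exists>c C. 0 < c \<and> c \<le> C \<and> (\<forall>i. \<forall>r1\<in>{a..b}. \<forall>r2\<in>{a..b}.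
        c * \<bar>r1 - r2\<bar> \<le> \<bar>inv_pos (\<lambda>r. \<sigma> r i) r1 - inv_pos (\<lambda>r. \<sigma> r i) r2\<bar> \<and>
        \<bar>inv_pos (\<lambda>r. \<sigma> r i) r1 - inv_pos (\<lambda>r. \<sigma> r i) r2\<bar> \<le> C * \<bar>r1 - r2\<bar>)))"

end

theory Submission
  imports Defs
begin

text \<open>
  Write \<open>s = \<sigma> r\<close>, \<open>t = \<sigma> R\<close> with \<open>r < R\<close> and suppose that \<open>s \<preceq> t\<close>. A component \<open>i\<close> either satisfies
  \<open>s i = r\<close>, and then \<open>t i - s i \<ge> R - r\<close>, or \<open>s i = \<Gamma> s i\<close>, and then \<open>t i - s i\<close> is at least a
  constant times \<open>t j - s j\<close> for each neighbour \<open>j \<in> I i\<close>. Since the iterates of \<open>\<Gamma>\<^sub>\<omega>\<close> fall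
  uniformly below \<open>r \<le> s i\<close>, a component of the first kind is reached from every \<open>i\<close> within a
  uniformly bounded number of steps; hence \<open>t i - s i \<ge> \<kappa> (R - r)\<close> uniformly in \<open>i\<close>.

  This gap makes \<open>{R > r. \<sigma> r \<preceq> \<sigma> R}\<close> open in \<open>{r<..}\<close>; it is also closed, and nonempty because
  \<open>\<sigma> r\<close> is bounded while every component of \<open>\<sigma> R\<close> is at least \<open>R\<close>. By connectedness \<open>\<sigma>\<close> is monotone,
  the gap estimate then holds unconditionally, and it is the upper Lipschitz bound on the inverses.
\<close>

section \<open>Comparison functions and their inverses on the half-line\<close>

lemma class_K_mono:
  assumes "f \<in> class_K" "0 \<le> x" "x \<le> y"
  shows "f x \<le> f y"
  using assms by (cases "x = y") (auto simp: class_K_def monotone_on_def less_le)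

lemma class_K_inj_on: "f \<in> class_K \<Longrightarrow> inj_on f {0..}"
  by (auto simp: class_K_def intro: strict_mono_on_imp_inj_on)

lemma class_K_inf_imp_class_K: "f \<in> class_K_inf \<Longrightarrow> f \<in> class_K"
  by (simp add: class_K_inf_def)

lemma class_K_inf_surj:
  assumes "f \<in> class_K_inf" "0 \<le> y"
  obtains x where "0 \<le> x" "f x = y"
proof -
  have f: "f \<in> class_K" and unb: "\<not> bdd_above (f ` {0..})"
    using assms(1) by (auto simp: class_K_inf_def)
  obtain b where b: "0 \<le> b" "y \<le> f b"
    using unb unfolding bdd_above_def by (metis (mono_tags) atLeast_iff imageE linear)
  have "continuous_on {0..b} f"
    using f by (auto simp: class_K_def intro: continuous_on_subset)
  moreover have "f 0 \<le> y"
    using f assms(2) by (simp add: class_K_def)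
  ultimately obtain x where "0 \<le> x" "f x = y"
    using IVT'[of f 0 y b] b by auto
  thus ?thesis by (rule that)
qed

lemma inv_pos_class_K_inf:
  assumes "f \<in> class_K_inf" "0 \<le> y"
  shows "0 \<le> inv_pos f y" and "f (inv_pos f y) = y"
proof -
  obtain x where x: "0 \<le> x" "f x = y"
    using class_K_inf_surj[OF assms] .
  have "inv_pos f y = x"
    unfolding inv_pos_def
    using x class_K_inj_on[OF class_K_inf_imp_class_K[OF assms(1)]]
    by (intro the_inv_into_f_eq) auto
  with x show "0 \<le> inv_pos f y" "f (inv_pos f y) = y" by auto
qed

lemma class_K_le_cancel:
  assumes "f \<in> class_K" "0 \<le> x" "0 \<le> y" "f x \<le> f y"
  shows "x \<le> y"
proof (rule ccontr)
  assume "\<not> x \<le> y"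
  hence "f y < f x"
    using assms by (auto simp: class_K_def monotone_on_def)
  with assms(4) show False by simp
qed

lemma inv_pos_mono:
  assumes "f \<in> class_K_inf" "0 \<le> x" "x \<le> y"
  shows "inv_pos f x \<le> inv_pos f y"
  using assms inv_pos_class_K_inf[OF assms(1)]
  by (auto intro!: class_K_le_cancel[OF class_K_inf_imp_class_K[OF assms(1)], of "inv_pos f x" "inv_pos f y"])

lemma inv_pos_ge:
  assumes "f \<in> class_K_inf" "\<And>r. r > 0 \<Longrightarrow> f r < r" "0 \<le> y"
  shows "y \<le> inv_pos f y"
  using inv_pos_class_K_inf[OF assms(1,3)] assms(2)[of "inv_pos f y"]
    class_K_inf_imp_class_K[OF assms(1)]
  by (cases "inv_pos f y = 0") (auto simp: class_K_def)

section \<open>Componentwise facts on sequences, and the enlarged operator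
  \<open>comp_inv\<close>\<close>

lemma const_bcontfun_apply [simp]: "apply_bcontfun (const_bcontfun c) x = c"
  by (simp add: const_bcontfun.rep_eq)

lemma norm_const_rseq [simp]: "norm (const_bcontfun r :: rseq) = \<bar>r\<bar>"
proof (rule antisym)
  show "norm (const_bcontfun r :: rseq) \<le> \<bar>r\<bar>"
    by (rule norm_bound) simp
  show "\<bar>r\<bar> \<le> norm (const_bcontfun r :: rseq)"
    using norm_bounded[of "const_bcontfun r :: rseq" 0] by simp
qed

lemma continuous_on_rseq_component:
  assumes "continuous_on S (\<sigma> :: 'a :: topological_space \<Rightarrow> rseq)"
  shows "continuous_on S (\<lambda>r. \<sigma> r i)"
proof -
  have "((\<lambda>r. \<sigma> r i) \<longlongrightarrow> \<sigma> x i) (at x within S)" if "x \<in> S" for x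
  proof -
    have "((\<lambda>r. dist (\<sigma> r) (\<sigma> x)) \<longlongrightarrow> 0) (at x within S)"
      using assms that tendsto_dist_iff unfolding continuous_on_def by blast
    hence "((\<lambda>r. dist (\<sigma> r i) (\<sigma> x i)) \<longlongrightarrow> 0) (at x within S)"
      by (rule tendsto_sandwich[OF _ _ tendsto_const, rotated 2]) (simp_all add: dist_bounded)
    thus ?thesis
      by (subst tendsto_dist_iff)
  qed
  thus ?thesis
    by (simp add: continuous_on_def)
qed

lemma rseq_le_norm: "(s :: rseq) i \<le> norm s"
  using norm_bounded[of s i] by simp

lemma comp_inv_apply:
  assumes "\<omega> \<in> class_K_inf" "\<Gamma> s \<in> ell_inf_pos"
  shows "comp_inv \<omega> \<Gamma> s i = inv_pos \<omega> (\<Gamma> s i)"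
proof -
  have "bounded (range (\<lambda>i. inv_pos \<omega> (\<Gamma> s i)))"
  proof (intro boundedI[where B = "inv_pos \<omega> (norm (\<Gamma> s))"], elim rangeE)
    fix x i assume x: "x = inv_pos \<omega> (\<Gamma> s i)"
    have "0 \<le> \<Gamma> s i" using assms(2) by (simp add: ell_inf_pos_def)
    from inv_pos_mono[OF assms(1) this rseq_le_norm] inv_pos_class_K_inf(1)[OF assms(1) this]
    show "norm x \<le> inv_pos \<omega> (norm (\<Gamma> s))" by (simp add: x)
  qed
  thus ?thesis
    by (simp add: comp_inv_def Bcontfun_seq)
qed

text \<open>Since \<omega> lies below the identity, its inverse lies above it. A chain of equalities
  \<open>s i = \<Gamma> s i\<close> can therefore be compared with the iterates of the enlarged
  operator, whose decay is known.\<close>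

lemma comp_inv_ge:
  assumes "\<omega> \<in> class_K_inf" "\<And>r. r > 0 \<Longrightarrow> \<omega> r < r" "\<Gamma> s \<in> ell_inf_pos"
  shows "\<Gamma> s i \<le> comp_inv \<omega> \<Gamma> s i"
  using assms(3) inv_pos_ge[OF assms(1,2)]
  by (simp add: comp_inv_apply[where \<Gamma> = \<Gamma> and s = s, OF assms(1,3)] ell_inf_pos_def)

lemma comp_inv_pos:
  assumes "\<omega> \<in> class_K_inf" "\<And>r. r > 0 \<Longrightarrow> \<omega> r < r" "\<Gamma> s \<in> ell_inf_pos"
  shows "comp_inv \<omega> \<Gamma> s \<in> ell_inf_pos"
  using comp_inv_ge[where \<Gamma> = \<Gamma> and s = s, OF assms] assms(3) order_trans unfolding ell_inf_pos_def by blast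

section \<open>The gains and the gain operator: monotonicity, uniform bounds, expansivity\<close>

lemma gain_mono:
  assumes "gain_data I \<gamma> \<mu>" "0 \<le> x" "x \<le> y"
  shows "\<gamma> i j x \<le> \<gamma> i j y"
proof -
  have "\<gamma> i j \<in> class_K \<or> (\<forall>r\<ge>0. \<gamma> i j r = 0)"
    using assms(1) by (simp add: gain_data_def)
  thus ?thesis
    using assms(2,3) class_K_mono by auto
qed

lemma gain_zero:
  assumes "gain_data I \<gamma> \<mu>"
  shows "\<gamma> i j 0 = 0"
proof -
  have "\<gamma> i j \<in> class_K \<or> (\<forall>r\<ge>0. \<gamma> i j r = 0)"
    using assms(1) by (simp add: gain_data_def)
  thus ?thesis
    by (auto simp: class_K_def)
qed

lemma gain_nonneg:
  assumes "gain_data I \<gamma> \<mu>" "0 \<le> x"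
  shows "0 \<le> \<gamma> i j x"
  using gain_mono[OF assms(1) order_refl assms(2)] gain_zero[OF assms(1)] by simp

lemma gain_outside: "gain_data I \<gamma> \<mu> \<Longrightarrow> j \<notin> I i \<Longrightarrow> 0 \<le> x \<Longrightarrow> \<gamma> i j x = 0"
  by (simp add: gain_data_def)

text \<open>Component \<open>i\<close> sees its argument only through the indices in
  \<open>I i\<close>, because all other gains vanish. A comparison on the neighbours alone is what
  an induction along neighbours can supply.\<close>

lemma gain_op_local_mono:
  assumes gd: "gain_data I \<gamma> \<mu>" and wd: "gain_well_defined \<gamma> \<mu>"
    and s: "s \<in> ell_inf_pos" and t: "t \<in> ell_inf_pos"
    and le: "\<And>j. j \<in> I i \<Longrightarrow> s j \<le> t j"
  shows "gain_op \<gamma> \<mu> s i \<le> gain_op \<gamma> \<mu> t i"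
proof -
  have pos: "0 \<le> s j" "0 \<le> t j" for j
    using s t by (auto simp: ell_inf_pos_def)
  have "\<gamma> i j (s j) \<le> \<gamma> i j (t j)" for j
    using gain_mono[OF gd pos(1) le] gain_outside[OF gd _ pos(1)] gain_outside[OF gd _ pos(2)]
    by (cases "j \<in> I i") auto
  hence "gain_vec \<gamma> s i \<preceq> gain_vec \<gamma> t i"
    by (simp add: seq_le_def gain_vec_apply[OF gd s] gain_vec_apply[OF gd t])
  moreover have "gain_vec \<gamma> s i \<in> ell_inf_pos" "gain_vec \<gamma> t i \<in> ell_inf_pos"
    using s t gain_nonneg[OF gd]
    by (auto simp: ell_inf_pos_def gain_vec_apply[OF gd s] gain_vec_apply[OF gd t])
  moreover have "MAF (\<mu> i)"
    using gd by (simp add: gain_data_def)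
  ultimately have "\<mu> i (gain_vec \<gamma> s i) \<le> \<mu> i (gain_vec \<gamma> t i)"
    by (auto simp: MAF_def)
  hence "ennreal (gain_op \<gamma> \<mu> s i) \<le> ennreal (gain_op \<gamma> \<mu> t i)"
    using gain_op_apply(1)[OF wd s] gain_op_apply(1)[OF wd t] by simp
  moreover have "0 \<le> gain_op \<gamma> \<mu> t i"
    using gain_op_apply(2)[OF wd t] by (simp add: ell_inf_pos_def)
  ultimately show ?thesis
    by (simp add: ennreal_le_iff)
qed

text \<open>Equicontinuity with tolerance 1 carries a common bound from a point to all nearby
  points, and back, at the cost of adding 1. The points with a common bound thus form a clopen set,
  which is everything once it contains \<open>x0\<close>.\<close>

lemma equicontinuous_pointwise_bounded:
  assumes eq: "pointwise_equicontinuous_on S F" and "connected S" "x0 \<in> S"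
    and x0: "\<And>f. f \<in> F \<Longrightarrow> \<bar>f x0\<bar> \<le> M0" and "x \<in> S"
  obtains M where "\<And>f. f \<in> F \<Longrightarrow> \<bar>f x\<bar> \<le> M"
proof -
  define B where "B = {y \<in> S. \<exists>M. \<forall>f\<in>F. \<bar>f y\<bar> \<le> M}"
  have near: "\<exists>d>0. \<forall>y\<in>S. dist y x < d \<longrightarrow> (x \<in> B \<longleftrightarrow> y \<in> B)" if "x \<in> S" for x
  proof -
    obtain d where d: "d > 0" "\<And>f y. f \<in> F \<Longrightarrow> y \<in> S \<Longrightarrow> dist y x < d \<Longrightarrow> dist (f y) (f x) < 1"
      using eq[unfolded pointwise_equicontinuous_on_def, rule_format, OF \<open>x \<in> S\<close> zero_less_one] by blast
    have "x \<in> B \<longleftrightarrow> y \<in> B" if y: "y \<in> S" "dist y x < d" for y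
    proof
      assume "x \<in> B"
      then obtain M where M: "\<And>f. f \<in> F \<Longrightarrow> \<bar>f x\<bar> \<le> M" by (auto simp: B_def)
      have "\<bar>f y\<bar> \<le> M + 1" if "f \<in> F" for f
        using M[OF that] d(2)[OF that y] by (simp add: dist_real_def)
      thus "y \<in> B" using y by (auto simp: B_def)
    next
      assume "y \<in> B"
      then obtain M where M: "\<And>f. f \<in> F \<Longrightarrow> \<bar>f y\<bar> \<le> M" by (auto simp: B_def)
      have "\<bar>f x\<bar> \<le> M + 1" if "f \<in> F" for f
        using M[OF that] d(2)[OF that y] by (simp add: dist_real_def)
      thus "x \<in> B" using \<open>x \<in> S\<close> by (auto simp: B_def)
    qed
    with d(1) show ?thesis by blast
  qed
  \<comment> \<open>The equivalence in \<open>near\<close> is symmetric, so the same argument shows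
    that \<open>B\<close> and its complement are open.\<close>
  have "openin (top_of_set S) C" if "C = B \<or> C = S - B" for C
    unfolding openin_euclidean_subtopology_iff
  proof (intro conjI ballI)
    show "C \<subseteq> S" using that by (auto simp: B_def)
    fix x assume "x \<in> C"
    with \<open>C \<subseteq> S\<close> obtain d where "d > 0" "\<forall>y\<in>S. dist y x < d \<longrightarrow> (x \<in> B \<longleftrightarrow> y \<in> B)"
      using near[of x] by blast
    thus "\<exists>e>0. \<forall>y\<in>S. dist y x < e \<longrightarrow> y \<in> C"
      using that \<open>x \<in> C\<close> by (intro exI[of _ d]) auto
  qed
  hence "openin (top_of_set S) B" "closedin (top_of_set S) B"
    by (auto simp: closedin_def B_def)
  hence "B = {} \<or> B = S"
    using \<open>connected S\<close> unfolding connected_clopen by blast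
  moreover have "x0 \<in> B"
    using x0 \<open>x0 \<in> S\<close> by (auto simp: B_def)
  ultimately have "x \<in> B"
    using \<open>x \<in> S\<close> by auto
  then obtain M where "\<forall>f\<in>F. \<bar>f x\<bar> \<le> M"
    by (auto simp: B_def)
  thus ?thesis
    by (intro that) auto
qed

text \<open>All gains vanish at 0, so equicontinuity bounds them uniformly at \<open>b\<close>, and
  monotonicity extends this to smaller arguments. From below, a gain is nonnegative at
  \<open>a/2\<close> and grows at least linearly from there to \<open>x\<close>.\<close>

lemma gain_bounds:
  assumes gd: "gain_data I \<gamma> \<mu>"
    and eq: "pointwise_equicontinuous_on {0..} {\<gamma> i j | i j. True}"
    and lower: "\<forall>a b. 0 < a \<and> a \<le> b \<longrightarrow> (\<exists>c>0. \<forall>i. \<forall>j\<in>I i. \<forall>r1\<in>{a..b}. \<forall>r2\<in>{a..b}.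
                  \<bar>\<gamma> i j r1 - \<gamma> i j r2\<bar> \<ge> c * \<bar>r1 - r2\<bar>)"
    and "0 < a" "a \<le> b"
  obtains R1 R2 where "0 < R1" "R1 < R2"
    "\<And>i j x. j \<in> I i \<Longrightarrow> a \<le> x \<Longrightarrow> x \<le> b \<Longrightarrow> R1 \<le> \<gamma> i j x \<and> \<gamma> i j x \<le> R2"
proof -
  obtain M where M: "\<And>f. f \<in> {\<gamma> i j | i j. True} \<Longrightarrow> \<bar>f b\<bar> \<le> M"
    using \<open>0 < a\<close> \<open>a \<le> b\<close> gain_zero[OF gd]
    by (elim equicontinuous_pointwise_bounded[OF eq, where x = b and ?x0.0 = 0 and ?M0.0 = 0, rotated -1]) auto
  \<comment> \<open>The uniform growth of the gains holds only on intervals away from 0, hence the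
    base point \<open>a/2\<close> instead of 0.\<close>
  have "0 < a / 2 \<and> a / 2 \<le> b"
    using assms(4,5) by simp
  with lower obtain c where c: "c > 0" "\<forall>i. \<forall>j\<in>I i. \<forall>r1\<in>{a/2..b}. \<forall>r2\<in>{a/2..b}.
      \<bar>\<gamma> i j r1 - \<gamma> i j r2\<bar> \<ge> c * \<bar>r1 - r2\<bar>"
    by meson
  show ?thesis
  \<comment> \<open>The extra \<open>+ 1\<close> makes the inequality between the two bounds strict,
    as \<open>MAF_expansive\<close> requires.\<close>
  proof (rule that[of "c * (a/2)" "max M (c * (a/2) + 1)"])
    show "0 < c * (a/2)" using c(1) assms(4) by simp
    show "c * (a/2) < max M (c * (a/2) + 1)" by linarith
    fix i j x assume j: "j \<in> I i" and x: "a \<le> x" "x \<le> b"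
    have "c * (a/2) \<le> c * \<bar>x - a/2\<bar>"
      using c(1) x(1) by (intro mult_left_mono) linarith+
    also have "\<dots> \<le> \<bar>\<gamma> i j x - \<gamma> i j (a/2)\<bar>"
      using c(2)[rule_format, OF j, of x "a/2"] x assms(4) by simp
    also have "\<dots> \<le> \<gamma> i j x"
      using gain_mono[OF gd, of "a/2" x i j] gain_nonneg[OF gd, of "a/2" i j] x assms(4) by simp
    finally have "c * (a/2) \<le> \<gamma> i j x" .
    moreover have "\<gamma> i j x \<le> M"
    proof -
      have "\<gamma> i j x \<le> \<gamma> i j b" using gain_mono[OF gd] x assms(4) by simp
      also have "\<dots> \<le> M" using M[of "\<gamma> i j"] by fastforce
      finally show ?thesis .
    qed
    ultimately show "c * (a/2) \<le> \<gamma> i j x \<and> \<gamma> i j x \<le> max M (c * (a/2) + 1)" by simp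
  qed
qed

text \<open>Two expansions compose: a gain expands by at least \<open>c\<close> on
  \<open>[a, b]\<close>, and the aggregation function by at least \<open>l\<close> on the box
  \<open>[R1, R2]\<close> that contains the gain values. Neither constant depends on
  \<open>i\<close> or \<open>j\<close>, so neither does \<open>q = l * c\<close>.\<close>

lemma gain_op_expansive:
  assumes gd: "gain_data I \<gamma> \<mu>" and wd: "gain_well_defined \<gamma> \<mu>"
    and eq: "pointwise_equicontinuous_on {0..} {\<gamma> i j | i j. True}"
    and expansive: "MAF_expansive I \<mu>"
    and lower: "\<forall>a b. 0 < a \<and> a \<le> b \<longrightarrow> (\<exists>c>0. \<forall>i. \<forall>j\<in>I i. \<forall>r1\<in>{a..b}. \<forall>r2\<in>{a..b}.
                  \<bar>\<gamma> i j r1 - \<gamma> i j r2\<bar> \<ge> c * \<bar>r1 - r2\<bar>)"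
    and ab: "0 < a" "a \<le> b"
  obtains q where "0 < q"
    "\<And>s t i j. const_bcontfun a \<preceq> s \<Longrightarrow> s \<preceq> t \<Longrightarrow> t \<preceq> const_bcontfun b \<Longrightarrow> j \<in> I i \<Longrightarrow>
       q * (t j - s j) \<le> gain_op \<gamma> \<mu> t i - gain_op \<gamma> \<mu> s i"
proof -
  obtain R1 R2 where R: "0 < R1" "R1 < R2"
    "\<And>i j x. j \<in> I i \<Longrightarrow> a \<le> x \<Longrightarrow> x \<le> b \<Longrightarrow> R1 \<le> \<gamma> i j x \<and> \<gamma> i j x \<le> R2"
    using gain_bounds[OF gd eq lower ab] by blast
  obtain l where l: "l > 0" "\<forall>i. \<forall>j\<in>I i. \<forall>s1 s2.
     const_bcontfun R1 \<preceq> s1 \<and> s1 \<preceq> s2 \<and> s2 \<preceq> const_bcontfun R2 \<longrightarrow>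
     enn2real (\<mu> i (restrict_seq (I i) s2)) - enn2real (\<mu> i (restrict_seq (I i) s1))
       \<ge> l * (s2 j - s1 j)"
    using expansive R(1,2) unfolding MAF_expansive_def by meson
  obtain c where c: "c > 0" "\<forall>i. \<forall>j\<in>I i. \<forall>r1\<in>{a..b}. \<forall>r2\<in>{a..b}.
      \<bar>\<gamma> i j r1 - \<gamma> i j r2\<bar> \<ge> c * \<bar>r1 - r2\<bar>"
    using lower ab by meson
  show ?thesis
  proof (rule that[of "l * c"])
    show "0 < l * c" using l(1) c(1) by simp
    fix s t :: rseq and i j
    assume s: "const_bcontfun a \<preceq> s" and st: "s \<preceq> t" and t: "t \<preceq> const_bcontfun b" and j: "j \<in> I i"
    have bd: "a \<le> s j" "s j \<le> t j" "t j \<le> b" for j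
      using s st t by (auto simp: seq_le_def)
    have bd': "s j \<le> b" "a \<le> t j" for j
      using bd[of j] by auto
    have pos: "s \<in> ell_inf_pos" "t \<in> ell_inf_pos"
      using bd(1) bd'(2) ab(1) by (auto simp: ell_inf_pos_def intro: order_trans[OF less_imp_le])
    text \<open>Outside \<open>I i\<close> the gain vector vanishes, so it is padded by \<open>R1\<close> before expansivity applies.\<close>
    define pad where "pad u = Bcontfun (\<lambda>j. if j \<in> I i then \<gamma> i j (u j) else R1)" for u :: rseq
    have pad: "pad u j = (if j \<in> I i then \<gamma> i j (u j) else R1)"
      if "\<And>j. a \<le> u j" "\<And>j. u j \<le> b" for u :: rseq and j
    proof -
      have "bounded (range (\<lambda>j. if j \<in> I i then \<gamma> i j (u j) else R1))"
      proof (intro boundedI[where B = R2], elim rangeE)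
        fix x j assume "x = (if j \<in> I i then \<gamma> i j (u j) else R1)"
        thus "norm x \<le> R2"
          using R(1,2) R(3)[of j i "u j"] that by (cases "j \<in> I i") auto
      qed
      thus ?thesis by (simp add: pad_def Bcontfun_seq)
    qed
    \<comment> \<open>Restriction removes the padding again, so the expansivity estimate for padded
      vectors is one for the gain operator itself.\<close>
    have restr: "restrict_seq (I i) (pad u) = gain_vec \<gamma> u i"
      if "\<And>j. a \<le> u j" "\<And>j. u j \<le> b" "u \<in> ell_inf_pos" for u :: rseq
      using that by (intro bcontfun_eqI)
        (auto simp: pad gain_vec_apply[OF gd] gain_outside[OF gd] ell_inf_pos_def)
    have gop: "gain_op \<gamma> \<mu> u i = enn2real (\<mu> i (gain_vec \<gamma> u i))" if "u \<in> ell_inf_pos" for u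
      using gain_op_apply(2)[OF wd that]
      by (simp add: gain_op_apply(1)[OF wd that, symmetric] ell_inf_pos_def)
    have gle: "\<gamma> i j (s j) \<le> \<gamma> i j (t j)" for j
      using bd ab(1) by (intro gain_mono[OF gd]) (auto intro: order_trans[OF less_imp_le])
    have "l * c * (t j - s j) \<le> l * (\<gamma> i j (t j) - \<gamma> i j (s j))"
    proof -
      have "c * \<bar>t j - s j\<bar> \<le> \<bar>\<gamma> i j (t j) - \<gamma> i j (s j)\<bar>"
        using c(2)[rule_format, OF j, of "t j" "s j"] bd bd' by simp
      hence "c * (t j - s j) \<le> \<gamma> i j (t j) - \<gamma> i j (s j)"
        using gle[of j] bd(2)[of j] by simp
      thus ?thesis using l(1) by (simp add: mult.assoc)
    qed
    also have "\<dots> = l * (pad t j - pad s j)"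
      using j bd bd' by (simp add: pad)
    also have "\<dots> \<le> enn2real (\<mu> i (restrict_seq (I i) (pad t))) - enn2real (\<mu> i (restrict_seq (I i) (pad s)))"
      using R(2) R(3)[OF _ bd(1) bd'(1)] R(3)[OF _ bd'(2) bd(3)] gle
      by (intro l(2)[rule_format, OF j]) (simp add: seq_le_def pad bd bd')
    also have "\<dots> = gain_op \<gamma> \<mu> t i - gain_op \<gamma> \<mu> s i"
      using bd bd' pos by (simp add: restr gop)
    finally show "l * c * (t j - s j) \<le> gain_op \<gamma> \<mu> t i - gain_op \<gamma> \<mu> s i" .
  qed
qed

section \<open>Fixed points of the truncated operators and the gap between them\<close>

lemma Fix_trunc_op:
  assumes "s \<in> Fix_pos (trunc_op \<Gamma> r)"
  shows "s \<in> ell_inf_pos" and "s i = max r (\<Gamma> s i)"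
proof -
  show "s \<in> ell_inf_pos" using assms by (simp add: Fix_pos_def)
  have "trunc_op \<Gamma> r s i = s i" using assms by (simp add: Fix_pos_def)
  thus "s i = max r (\<Gamma> s i)" by (simp add: trunc_op_def)
qed

text \<open>The induction follows neighbours for \<open>k\<close> steps. If a component with value
  \<open>r\<close> is met, the gap \<open>R - r\<close> found there is passed back with a factor
  \<open>q\<close> per step; otherwise monotonicity alone gives domination by the iterate.
  \<open>T\<close> stands for the enlarged operator.\<close>

lemma gap_dichotomy:
  fixes T \<Gamma> :: "rseq \<Rightarrow> rseq" and I :: "nat \<Rightarrow> nat set"
  assumes T_pos: "\<And>u. u \<in> ell_inf_pos \<Longrightarrow> T u \<in> ell_inf_pos"
    and mono: "\<And>u v i. u \<in> ell_inf_pos \<Longrightarrow> v \<in> ell_inf_pos \<Longrightarrow> (\<And>j. j \<in> I i \<Longrightarrow> u j \<le> v j) \<Longrightarrow> \<Gamma> u i \<le> T v i"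
    and s: "s \<in> Fix_pos (trunc_op \<Gamma> r)" and t: "t \<in> Fix_pos (trunc_op \<Gamma> R)" and "r \<le> R"
    and expand: "\<And>i j. j \<in> I i \<Longrightarrow> q * (t j - s j) \<le> \<Gamma> t i - \<Gamma> s i"
    and q: "0 \<le> q" "q \<le> 1"
  shows "s i \<le> (T ^^ k) s i \<or> q ^ k * (R - r) \<le> t i - s i"
proof (induction k arbitrary: i)
  case 0
  show ?case by simp
next
  case (Suc k)
  note fix_s = Fix_trunc_op[OF s] and fix_t = Fix_trunc_op[OF t]
  have iter: "(T ^^ k) s \<in> ell_inf_pos"
    using fix_s(1) T_pos by (induction k) auto
  \<comment> \<open>When \<open>s i\<close> is not \<open>r\<close>, the induction hypothesis is
    applied to each neighbour: either all are dominated by the iterate, or one has the gap. An empty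
    \<open>I i\<close> falls under the former.\<close>
  consider "s i = r" | "s i = \<Gamma> s i" "\<forall>j\<in>I i. s j \<le> (T ^^ k) s j"
    | j where "s i = \<Gamma> s i" "j \<in> I i" "q ^ k * (R - r) \<le> t j - s j"
    using Suc.IH fix_s(2)[of i] by (metis max_def)
  thus ?case
  proof cases
    case 1
    have "q ^ Suc k * (R - r) \<le> 1 * (R - r)"
      using q \<open>r \<le> R\<close> by (intro mult_right_mono power_le_one) auto
    also have "\<dots> \<le> t i - s i"
      using 1 fix_t(2)[of i] by simp
    finally show ?thesis ..
  next
    case 2
    thus ?thesis using mono[OF fix_s(1) iter] by simp
  next
    case 3
    have "q ^ Suc k * (R - r) \<le> q * (t j - s j)"
      using 3(3) q(1) by (simp add: mult.assoc mult_left_mono)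
    also have "\<dots> \<le> \<Gamma> t i - \<Gamma> s i" using expand[OF 3(2)] .
    also have "\<dots> \<le> t i - s i" using 3(1) fix_t(2)[of i] by simp
    finally show ?thesis ..
  qed
qed

text \<open>A fixed point satisfies the MBI inequality with the constant sequence \<open>r\<close>
  as input, whose norm is \<open>r\<close>.\<close>

lemma Fix_trunc_op_bound:
  assumes MBI: "\<And>s b. s \<in> ell_inf_pos \<Longrightarrow> b \<in> ell_inf_pos \<Longrightarrow> s \<preceq> \<Gamma> s \<oplus> b \<Longrightarrow> norm s \<le> \<phi> (norm b)"
    and "s \<in> Fix_pos (trunc_op \<Gamma> r)" "0 \<le> r"
  shows "norm s \<le> \<phi> r"
proof -
  have "s \<preceq> \<Gamma> s \<oplus> const_bcontfun r"
    using Fix_trunc_op(2)[OF assms(2)] by (auto simp: seq_le_def max.commute)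
  from MBI[OF Fix_trunc_op(1)[OF assms(2)] _ this] show ?thesis
    using assms(3) by (simp add: ell_inf_pos_def)
qed

text \<open>All fixed points for parameters in \<open>[a, b]\<close> have components in one interval
  \<open>[a, M]\<close>. Choosing \<open>N\<close> with \<open>\<beta> M N < a\<close> rules out the
  domination alternative of \<open>gap_dichotomy\<close>, uniformly in the index, so \<kappa>
  depends on \<open>a\<close> and \<open>b\<close> but not on \<open>i\<close>.\<close>

lemma selection_gap:
  assumes gd: "gain_data I \<gamma> \<mu>" and wd: "gain_well_defined \<gamma> \<mu>"
    and eq: "pointwise_equicontinuous_on {0..} {\<gamma> i j | i j. True}"
    and MBI: "max_MBI (gain_op \<gamma> \<mu>)"
    and stable: "\<exists>\<omega>\<in>class_K_inf. (\<forall>r>0. \<omega> r < r) \<and> UGAS (comp_inv \<omega> (gain_op \<gamma> \<mu>))"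
    and expansive: "MAF_expansive I \<mu>"
    and lower: "\<forall>a b. 0 < a \<and> a \<le> b \<longrightarrow> (\<exists>c>0. \<forall>i. \<forall>j\<in>I i. \<forall>r1\<in>{a..b}. \<forall>r2\<in>{a..b}.
                  \<bar>\<gamma> i j r1 - \<gamma> i j r2\<bar> \<ge> c * \<bar>r1 - r2\<bar>)"
    and ab: "0 < a" "a \<le> b"
  obtains \<kappa> where "0 < \<kappa>"
    "\<And>r R s t i. a \<le> r \<Longrightarrow> r \<le> R \<Longrightarrow> R \<le> b \<Longrightarrow> s \<in> Fix_pos (trunc_op (gain_op \<gamma> \<mu>) r) \<Longrightarrow>
       t \<in> Fix_pos (trunc_op (gain_op \<gamma> \<mu>) R) \<Longrightarrow> s \<preceq> t \<Longrightarrow> \<kappa> * (R - r) \<le> t i - s i"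
proof -
  let ?\<Gamma> = "gain_op \<gamma> \<mu>"
  obtain \<phi> where \<phi>: "\<phi> \<in> class_K"
    and MBI': "\<And>s b. s \<in> ell_inf_pos \<Longrightarrow> b \<in> ell_inf_pos \<Longrightarrow> s \<preceq> ?\<Gamma> s \<oplus> b \<Longrightarrow> norm s \<le> \<phi> (norm b)"
    using MBI unfolding max_MBI_def class_K_inf_def by auto
  obtain \<omega> \<beta> where \<omega>: "\<omega> \<in> class_K_inf" "\<And>r. r > 0 \<Longrightarrow> \<omega> r < r" and \<beta>: "\<beta> \<in> class_KL"
    and decay: "\<And>s k. s \<in> ell_inf_pos \<Longrightarrow> norm ((comp_inv \<omega> ?\<Gamma> ^^ k) s) \<le> \<beta> (norm s) (real k)"
    using stable unfolding UGAS_def by blast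
  let ?T = "comp_inv \<omega> ?\<Gamma>"
  \<comment> \<open>The maximum with \<open>b\<close> ensures that \<open>[a, M]\<close> is a proper
    interval and that \<open>M\<close> is positive, so that \<beta> tends to 0 along it.\<close>
  define M where "M = max b (\<phi> b)"
  have M: "a \<le> M" "0 < M" using ab by (auto simp: M_def)
  have norm_le: "norm s \<le> M" if "s \<in> Fix_pos (trunc_op ?\<Gamma> r)" "0 \<le> r" "r \<le> b" for s r
  proof -
    have "norm s \<le> \<phi> r" by (rule Fix_trunc_op_bound[where \<Gamma> = ?\<Gamma> and \<phi> = \<phi>, OF MBI' that(1,2)])
    also have "\<dots> \<le> \<phi> b" using class_K_mono[OF \<phi> that(2,3)] .
    finally show ?thesis by (simp add: M_def)
  qed
  have "(\<beta> M \<longlongrightarrow> 0) at_top"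
    using \<beta> M(2) by (simp add: class_KL_def)
  hence "((\<lambda>k. \<beta> M (real k)) \<longlongrightarrow> 0) sequentially"
    by (rule filterlim_compose[OF _ filterlim_real_sequentially])
  hence "eventually (\<lambda>k. \<beta> M (real k) < a) sequentially"
    using ab(1) by (rule order_tendstoD)
  then obtain N where N: "\<beta> M (real N) < a"
    by (auto simp: eventually_sequentially)
  obtain q where q: "0 < q"
    "\<And>s t i j. const_bcontfun a \<preceq> s \<Longrightarrow> s \<preceq> t \<Longrightarrow> t \<preceq> const_bcontfun M \<Longrightarrow> j \<in> I i \<Longrightarrow>
       q * (t j - s j) \<le> ?\<Gamma> t i - ?\<Gamma> s i"
    using gain_op_expansive[OF gd wd eq expansive lower ab(1) M(1)] by blast
  show ?thesis
  \<comment> \<open>The dichotomy needs a factor of at most 1, so \<open>q\<close> is cut off at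
    1.\<close>
  proof (rule that[of "min q 1 ^ N"])
    show "0 < min q 1 ^ N" using q(1) by simp
    fix r R :: real and s t i
    assume r: "a \<le> r" "r \<le> R" "R \<le> b" and s: "s \<in> Fix_pos (trunc_op ?\<Gamma> r)"
      and t: "t \<in> Fix_pos (trunc_op ?\<Gamma> R)" and st: "s \<preceq> t"
    have s_ge: "a \<le> s j" for j
      using Fix_trunc_op(2)[OF s, of j] r(1) by simp
    have t_le: "t \<preceq> const_bcontfun M"
      unfolding seq_le_def using norm_le[OF t] rseq_le_norm[of t] r ab(1)
      by (metis const_bcontfun_apply less_imp_le order_trans)
    have T_pos: "?T u \<in> ell_inf_pos" if "u \<in> ell_inf_pos" for u
      by (rule comp_inv_pos[where \<Gamma> = ?\<Gamma>, OF \<omega> gain_op_apply(2)[OF wd that]])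
    have T_mono: "?\<Gamma> u i \<le> ?T v i"
      if "u \<in> ell_inf_pos" "v \<in> ell_inf_pos" "\<And>j. j \<in> I i \<Longrightarrow> u j \<le> v j" for u v i
    proof -
      have "?\<Gamma> u i \<le> ?\<Gamma> v i" using gain_op_local_mono[OF gd wd that] .
      also have "\<dots> \<le> ?T v i" by (rule comp_inv_ge[where \<Gamma> = ?\<Gamma>, OF \<omega> gain_op_apply(2)[OF wd that(2)]])
      finally show ?thesis .
    qed
    have expand: "min q 1 * (t j - s j) \<le> ?\<Gamma> t i - ?\<Gamma> s i" if "j \<in> I i" for i j
    proof -
      have "min q 1 * (t j - s j) \<le> q * (t j - s j)"
        using st by (intro mult_right_mono) (auto simp: seq_le_def)
      also have "\<dots> \<le> ?\<Gamma> t i - ?\<Gamma> s i"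
        using q(2)[OF _ st t_le that] s_ge by (simp add: seq_le_def)
      finally show ?thesis .
    qed
    \<comment> \<open>Decay pushes the iterate below \<open>a\<close>, whereas every component of
      the fixed point is at least \<open>r\<close>, hence at least \<open>a\<close>.\<close>
    have "(?T ^^ N) s i < s i"
    proof -
      have "(?T ^^ N) s i \<le> \<beta> (norm s) (real N)"
        using rseq_le_norm decay[OF Fix_trunc_op(1)[OF s]] order_trans by blast
      also have "\<dots> \<le> \<beta> M (real N)"
        using \<beta> norm_le[OF s] r ab(1)
        by (intro class_K_mono[where f = "\<lambda>r. \<beta> r (real N)"]) (auto simp: class_KL_def)
      also have "\<dots> < s i" using N s_ge[of i] by simp
      finally show ?thesis .
    qed
    moreover have "s i \<le> (?T ^^ N) s i \<or> min q 1 ^ N * (R - r) \<le> t i - s i"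
      using q(1) by (intro gap_dichotomy[OF T_pos T_mono s t r(2) expand]) auto
    ultimately show "min q 1 ^ N * (R - r) \<le> t i - s i" by simp
  qed
qed

section \<open>Local Lipschitz continuity and monotonicity of the selection\<close>

lemma locally_Lipschitz_on_imp_continuous_on:
  assumes "locally_Lipschitz_on S f" "open S"
  shows "continuous_on S f"
proof (rule continuous_at_imp_continuous_on, rule ballI)
  fix x assume "x \<in> S"
  then obtain u L where u: "u > 0" "L-lipschitz_on (cball x u \<inter> S) f"
    using assms(1) unfolding locally_Lipschitz_on_def by blast
  hence "continuous_on (ball x u \<inter> S) f"
    by (auto intro: continuous_on_subset[OF lipschitz_on_continuous_on])
  thus "isCont f x"
    using u(1) \<open>x \<in> S\<close> assms(2) by (simp add: continuous_on_eq_continuous_at open_Int)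
qed

lemma locally_Lipschitz_on_compact:
  assumes "locally_Lipschitz_on S f" "compact K" "K \<subseteq> S"
  obtains L where "L-lipschitz_on K f"
proof -
  \<comment> \<open>The compactness result concerns maps with a time parameter; \<open>f\<close> is
    viewed as constant over the single time 0.\<close>
  have "local_lipschitz {0 :: real} K (\<lambda>_. f)"
    unfolding local_lipschitz_def
  proof (intro ballI)
    fix x t assume "x \<in> K"
    then obtain u L where "u > 0" "L-lipschitz_on (cball x u \<inter> S) f"
      using assms(1,3) unfolding locally_Lipschitz_on_def by blast
    thus "\<exists>u>0. \<exists>L. \<forall>t\<in>cball t u \<inter> {0 :: real}. L-lipschitz_on (cball x u \<inter> K) f"
      using assms(3) lipschitz_on_subset by blast
  qed
  from local_lipschitz_compact_implies_lipschitz[OF this assms(2)] that show ?thesis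
    by auto
qed

text \<open>The gap estimate presupposes order, so order is established first by connectedness.
  Openness relies on a margin that is uniform in \<open>i\<close>, since norm continuity moves all
  components by at most a common amount.\<close>

lemma mono_selection:
  assumes cont: "continuous_on {0<..} \<sigma>"
    and gap: "\<And>a b. 0 < a \<Longrightarrow> a \<le> b \<Longrightarrow> \<exists>\<kappa>>0. \<forall>r R i. a \<le> r \<longrightarrow> r \<le> R \<longrightarrow> R \<le> b \<longrightarrow> \<sigma> r \<preceq> \<sigma> R \<longrightarrow>
       \<kappa> * (R - r) \<le> \<sigma> R i - \<sigma> r i"
    and ge: "\<And>r i. 0 < r \<Longrightarrow> r \<le> \<sigma> r i"
    and r: "0 < r" "r < R"
  shows "\<sigma> r \<preceq> \<sigma> R"
proof -
  \<comment> \<open>The point \<open>r\<close> itself is left out: the margin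
    \<open>\<kappa> * (x - r)\<close> vanishes there.\<close>
  define U where "U = {R \<in> {r<..}. \<sigma> r \<preceq> \<sigma> R}"
  have cont': "continuous_on {r<..} \<sigma>"
    using cont r by (auto intro: continuous_on_subset)
  have "openin (top_of_set {r<..}) U"
    unfolding openin_euclidean_subtopology_iff
  proof (intro conjI ballI)
    show "U \<subseteq> {r<..}" by (auto simp: U_def)
    fix x assume "x \<in> U"
    hence x: "r < x" "\<sigma> r \<preceq> \<sigma> x" by (auto simp: U_def)
    obtain \<kappa> where \<kappa>: "\<kappa> > 0" "\<And>i. \<kappa> * (x - r) \<le> \<sigma> x i - \<sigma> r i"
      using gap[of r x] r(1) x by (meson less_imp_le order_refl)
    have "\<kappa> * (x - r) > 0" using \<kappa>(1) x(1) by simp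
    then obtain d where d: "d > 0"
      "\<And>y. y \<in> {r<..} \<Longrightarrow> dist y x < d \<Longrightarrow> dist (\<sigma> y) (\<sigma> x) < \<kappa> * (x - r)"
      using cont' x(1) unfolding continuous_on_iff by (metis greaterThan_iff)
    have "y \<in> U" if y: "y \<in> {r<..}" "dist y x < d" for y
    proof -
      have "\<sigma> r i \<le> \<sigma> y i" for i
      proof -
        have "\<bar>\<sigma> y i - \<sigma> x i\<bar> \<le> dist (\<sigma> y) (\<sigma> x)"
          using dist_bounded[of "\<sigma> y" i "\<sigma> x"] by (simp add: dist_real_def)
        thus ?thesis using \<kappa>(2)[of i] d(2)[OF y] by linarith
      qed
      thus ?thesis using y(1) by (simp add: U_def seq_le_def)
    qed
    with d(1) show "\<exists>e>0. \<forall>y\<in>{r<..}. dist y x < e \<longrightarrow> y \<in> U" by blast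
  qed
  moreover have "closedin (top_of_set {r<..}) U"
  proof -
    \<comment> \<open>Closedness needs no uniformity, as each component gives a closed
      condition.\<close>
    have "U = (\<Inter>i. {R \<in> {r<..}. \<sigma> r i \<le> \<sigma> R i})"
      by (auto simp: U_def seq_le_def)
    moreover have "closedin (top_of_set {r<..}) {R \<in> {r<..}. \<sigma> r i \<le> \<sigma> R i}" for i
    proof -
      have "continuous_on {r<..} (\<lambda>R. \<sigma> R i)"
        by (rule continuous_on_rseq_component[OF cont'])
      from continuous_closedin_preimage[OF this closed_atLeast[of "\<sigma> r i"]] show ?thesis
        by (simp add: Int_def vimage_def)
    qed
    ultimately show ?thesis by (simp add: closedin_INT)
  qed
  \<comment> \<open>Every component of \<sigma> at this parameter is at least the parameter, hence
    at least the norm of \<open>\<sigma> r\<close>. The norm is positive, which places the parameter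
    to the right of \<open>r\<close>.\<close>
  moreover have "norm (\<sigma> r) + r \<in> U"
  proof -
    have "0 < norm (\<sigma> r)"
      using ge[OF r(1), of 0] r(1) rseq_le_norm[of "\<sigma> r" 0] by linarith
    moreover have "\<sigma> r i \<le> \<sigma> (norm (\<sigma> r) + r) i" for i
      using rseq_le_norm[of "\<sigma> r" i] ge[of "norm (\<sigma> r) + r" i] calculation r(1) by linarith
    ultimately show ?thesis by (simp add: U_def seq_le_def)
  qed
  ultimately have "U = {r<..}"
    using connected_Ioi[of r] unfolding connected_clopen by blast
  thus ?thesis using r(2) by (auto simp: U_def)
qed

section \<open>Verification of the four properties of a path of decay\<close>

theorem theorem5p6:
  fixes I :: "nat \<Rightarrow> nat set"
    and \<gamma> :: "nat \<Rightarrow> nat \<Rightarrow> real \<Rightarrow> real"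
    and \<mu> :: "nat \<Rightarrow> rseq \<Rightarrow> ennreal"
    and \<sigma> :: "real \<Rightarrow> rseq"
  assumes gain: "gain_data I \<gamma> \<mu>"
    and well_def: "gain_well_defined \<gamma> \<mu>"
    and cont: "continuous_on ell_inf_pos (gain_op \<gamma> \<mu>)"
    and equicont: "pointwise_equicontinuous_on {0..} {\<gamma> i j | i j. True}"
    and MBI: "max_MBI (gain_op \<gamma> \<mu>)"
    and stable: "\<exists>\<omega>\<in>class_K_inf. (\<forall>r>0. \<omega> r < r) \<and> UGAS (comp_inv \<omega> (gain_op \<gamma> \<mu>))"
    and expansive: "MAF_expansive I \<mu>"
    and lower: "\<forall>a b. 0 < a \<and> a \<le> b \<longrightarrow> (\<exists>c>0. \<forall>i. \<forall>j\<in>I i. \<forall>r1\<in>{a..b}. \<forall>r2\<in>{a..b}.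
                  \<bar>\<gamma> i j r1 - \<gamma> i j r2\<bar> \<ge> c * \<bar>r1 - r2\<bar>)"
    and selection: "\<forall>r\<ge>0. \<sigma> r \<in> Fix_pos (trunc_op (gain_op \<gamma> \<mu>) r)"
    and lipschitz: "locally_Lipschitz_on {0<..} \<sigma>"
  shows "path_of_decay (gain_op \<gamma> \<mu>) \<sigma>"
proof -
  let ?\<Gamma> = "gain_op \<gamma> \<mu>"
  obtain \<phi> where \<phi>: "\<phi> \<in> class_K_inf"
    and MBI': "\<And>s b. s \<in> ell_inf_pos \<Longrightarrow> b \<in> ell_inf_pos \<Longrightarrow> s \<preceq> ?\<Gamma> s \<oplus> b \<Longrightarrow> norm s \<le> \<phi> (norm b)"
    using MBI unfolding max_MBI_def by auto
  note \<phi>K = class_K_inf_imp_class_K[OF \<phi>]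
  have fp: "\<sigma> r i = max r (?\<Gamma> (\<sigma> r) i)" if "0 \<le> r" for r i
    using selection that Fix_trunc_op(2) by blast
  have ge: "r \<le> \<sigma> r i" if "0 \<le> r" for r i
    using fp[OF that, of i] by simp
  have le: "\<sigma> r i \<le> \<phi> r" if "0 \<le> r" for r i
    using Fix_trunc_op_bound[where \<Gamma> = ?\<Gamma> and \<phi> = \<phi> and s = "\<sigma> r" and r = r, OF MBI']
      selection that rseq_le_norm order_trans by blast
  have zero: "\<sigma> 0 i = 0" for i
    using ge[of 0 i] le[of 0 i] \<phi>K by (simp add: class_K_def)

  have gap: "\<exists>\<kappa>>0. \<forall>r R i. a \<le> r \<longrightarrow> r \<le> R \<longrightarrow> R \<le> b \<longrightarrow> \<sigma> r \<preceq> \<sigma> R \<longrightarrow>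
      \<kappa> * (R - r) \<le> \<sigma> R i - \<sigma> r i" if ab: "0 < a" "a \<le> b" for a b
  proof -
    obtain \<kappa> where "0 < \<kappa>"
      "\<And>r R s t i. a \<le> r \<Longrightarrow> r \<le> R \<Longrightarrow> R \<le> b \<Longrightarrow> s \<in> Fix_pos (trunc_op ?\<Gamma> r) \<Longrightarrow>
         t \<in> Fix_pos (trunc_op ?\<Gamma> R) \<Longrightarrow> s \<preceq> t \<Longrightarrow> \<kappa> * (R - r) \<le> t i - s i"
      using selection_gap[OF gain well_def equicont MBI stable expansive lower ab] by blast
    thus ?thesis using selection ab(1) by (intro exI[of _ \<kappa>]) auto
  qed
  have cont\<sigma>: "continuous_on {0<..} \<sigma>"
    using locally_Lipschitz_on_imp_continuous_on[OF lipschitz] by simp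
  have mono: "\<sigma> r \<preceq> \<sigma> R" if "0 < r" "r \<le> R" for r R
    using mono_selection[OF cont\<sigma> gap ge, of r R] that
    by (cases "r = R") (auto simp: seq_le_def)
  have gap_abs: "\<exists>\<kappa>>0. \<forall>r\<in>{a..b}. \<forall>R\<in>{a..b}. \<forall>i. \<kappa> * \<bar>r - R\<bar> \<le> \<bar>\<sigma> r i - \<sigma> R i\<bar>"
    if ab: "0 < a" "a \<le> b" for a b
  proof -
    obtain \<kappa> where \<kappa>: "\<kappa> > 0" "\<And>r R i. a \<le> r \<Longrightarrow> r \<le> R \<Longrightarrow> R \<le> b \<Longrightarrow> \<kappa> * (R - r) \<le> \<sigma> R i - \<sigma> r i"
      using gap[OF ab] mono ab(1) by (meson less_le_trans)
    have "\<kappa> * \<bar>r - R\<bar> \<le> \<bar>\<sigma> r i - \<sigma> R i\<bar>" if "r \<in> {a..b}" "R \<in> {a..b}" for r R i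
      using \<kappa>(2)[of r R i] \<kappa>(2)[of R r i] that by (cases "r \<le> R") auto
    with \<kappa>(1) show ?thesis by blast
  qed

  have K: "(\<lambda>r. \<sigma> r i) \<in> class_K_inf" for i
  proof -
    have "continuous_on {0..} (\<lambda>r. \<sigma> r i)"
    proof -
      have "continuous (at x within {0..}) (\<lambda>r. \<sigma> r i)" if "x \<ge> 0" for x
      proof (cases "x = 0")
        case True
        \<comment> \<open>The Lipschitz hypothesis does not reach 0; continuity there comes from
          squeezing each component between 0 and \<phi>.\<close>
        have "(\<phi> \<longlongrightarrow> 0) (at 0 within {0..})"
          using \<phi>K by (auto simp: class_K_def continuous_on_def dest: bspec[of _ _ 0])
        hence "((\<lambda>r. \<sigma> r i) \<longlongrightarrow> 0) (at 0 within {0..})"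
          by (rule tendsto_sandwich[OF _ _ tendsto_const, rotated 2])
             (auto simp: eventually_at_filter intro!: always_eventually le order_trans[OF _ ge])
        thus ?thesis using True by (simp add: continuous_within zero)
      next
        case False
        have "continuous_on {0<..} (\<lambda>r. \<sigma> r i)"
          by (rule continuous_on_rseq_component[OF cont\<sigma>])
        hence "isCont (\<lambda>r. \<sigma> r i) x"
          using False that by (simp add: continuous_on_eq_continuous_at)
        thus ?thesis by (rule continuous_at_imp_continuous_at_within)
      qed
      thus ?thesis by (simp add: continuous_on_eq_continuous_within)
    qed
    moreover have "\<sigma> r i < \<sigma> R i" if rR: "0 \<le> r" "r < R" for r R
    \<comment> \<open>The gap estimate is restricted to positive parameters. At 0 strictness follows
      from \<open>\<sigma> R i \<ge> R\<close>.\<close>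
    proof (cases "r = 0")
      case True
      thus ?thesis using ge[of R i] rR zero[of i] by simp
    next
      case False
      then obtain \<kappa> where "\<kappa> > 0" "\<kappa> * (R - r) \<le> \<sigma> R i - \<sigma> r i"
        using gap[of r R] mono[of r R] rR by (metis less_eq_real_def)
      moreover have "0 < \<kappa> * (R - r)" using calculation(1) rR(2) by simp
      ultimately show ?thesis by linarith
    qed
    moreover have "\<not> bdd_above ((\<lambda>r. \<sigma> r i) ` {0..})"
    proof
      assume "bdd_above ((\<lambda>r. \<sigma> r i) ` {0..})"
      then obtain M where M: "\<And>r. 0 \<le> r \<Longrightarrow> \<sigma> r i \<le> M" by (auto simp: bdd_above_def)
      show False using M[of "max M 0 + 1"] ge[of "max M 0 + 1" i] by simp
    qed
    ultimately show ?thesis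
      by (simp add: class_K_inf_def class_K_def monotone_on_def zero)
  qed

  have inverse: "\<exists>c C. 0 < c \<and> c \<le> C \<and> (\<forall>i. \<forall>r1\<in>{a..b}. \<forall>r2\<in>{a..b}.
        c * \<bar>r1 - r2\<bar> \<le> \<bar>inv_pos (\<lambda>r. \<sigma> r i) r1 - inv_pos (\<lambda>r. \<sigma> r i) r2\<bar> \<and>
        \<bar>inv_pos (\<lambda>r. \<sigma> r i) r1 - inv_pos (\<lambda>r. \<sigma> r i) r2\<bar> \<le> C * \<bar>r1 - r2\<bar>)"
    if ab: "0 < a" "a \<le> b" for a b
  proof -
    \<comment> \<open>From \<open>r \<le> \<sigma> r i \<le> \<phi> r\<close>, the preimage of
      \<open>[a, b]\<close> under every component lies in \<open>[a', b]\<close>, a compact subset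
      of the positive half-line that is independent of \<open>i\<close>.\<close>
    define a' where "a' = inv_pos \<phi> a"
    have a'_nonneg: "0 \<le> a'" and \<phi>a': "\<phi> a' = a"
      using inv_pos_class_K_inf[OF \<phi>, of a] ab(1) by (auto simp: a'_def)
    have a': "0 < a'"
      using a'_nonneg \<phi>a' ab(1) \<phi>K by (cases "a' = 0") (auto simp: class_K_def)
    have inv: "inv_pos (\<lambda>r. \<sigma> r i) r \<in> {a'..b}" "\<sigma> (inv_pos (\<lambda>r. \<sigma> r i) r) i = r"
      if "r \<in> {a..b}" for r i
    proof -
      let ?x = "inv_pos (\<lambda>r. \<sigma> r i) r"
      have x: "0 \<le> ?x" "\<sigma> ?x i = r"
        using inv_pos_class_K_inf[OF K, of r i] that ab(1) by auto
      have "\<phi> a' \<le> \<phi> ?x"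
        using le[OF x(1), of i] x(2) that \<phi>a' by simp
      hence "a' \<le> ?x"
        using class_K_le_cancel[OF \<phi>K a'_nonneg x(1)] by blast
      moreover have "?x \<le> b"
        using ge[OF x(1), of i] x(2) that by simp
      ultimately show "?x \<in> {a'..b}" "\<sigma> ?x i = r"
        using x(2) by auto
    qed
    have "a' \<le> b" using inv(1)[of a 0] ab by simp
    obtain \<kappa> where \<kappa>: "\<kappa> > 0"
      "\<And>r R i. r \<in> {a'..b} \<Longrightarrow> R \<in> {a'..b} \<Longrightarrow> \<kappa> * \<bar>r - R\<bar> \<le> \<bar>\<sigma> r i - \<sigma> R i\<bar>"
      using gap_abs[OF a' \<open>a' \<le> b\<close>] by blast
    obtain L where L: "L-lipschitz_on {a'..b} \<sigma>"
      using locally_Lipschitz_on_compact[OF lipschitz, of "{a'..b}"] a' by fastforce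
    \<comment> \<open>Enlarging \<open>L\<close> makes it positive and at least \<kappa>, so that
      \<open>1 / L'\<close> and \<open>1 / \<kappa>\<close> are ordered as the constants
      \<open>c\<close> and \<open>C\<close> must be.\<close>
    define L' where "L' = max L \<kappa>"
    have L': "0 < L'" "\<kappa> \<le> L'" using \<kappa>(1) by (auto simp: L'_def)
    have lip: "\<bar>\<sigma> r i - \<sigma> R i\<bar> \<le> L' * \<bar>r - R\<bar>" if "r \<in> {a'..b}" "R \<in> {a'..b}" for r R i
    proof -
      have "\<bar>\<sigma> r i - \<sigma> R i\<bar> \<le> dist (\<sigma> r) (\<sigma> R)"
        using dist_bounded[of "\<sigma> r" i "\<sigma> R"] by (simp add: dist_real_def)
      also have "\<dots> \<le> L * \<bar>r - R\<bar>"
        using lipschitz_onD[OF L that] by (simp add: dist_real_def)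
      also have "\<dots> \<le> L' * \<bar>r - R\<bar>"
        by (intro mult_right_mono) (auto simp: L'_def)
      finally show ?thesis .
    qed
    show ?thesis
    proof (rule exI[of _ "1 / L'"], rule exI[of _ "1 / \<kappa>"], intro conjI allI ballI)
      show "0 < 1 / L'" "1 / L' \<le> 1 / \<kappa>"
        using L' \<kappa>(1) by (simp_all add: frac_le)
      fix i r1 r2 assume r: "r1 \<in> {a..b}" "r2 \<in> {a..b}"
      let ?d = "\<bar>inv_pos (\<lambda>r. \<sigma> r i) r1 - inv_pos (\<lambda>r. \<sigma> r i) r2\<bar>"
      \<comment> \<open>Both estimates for \<sigma> are evaluated at the inverse images of
        \<open>r1\<close> and \<open>r2\<close>; inversion exchanges the roles of upper and lower
        bound.\<close>
      have "\<bar>r1 - r2\<bar> \<le> L' * ?d" "\<kappa> * ?d \<le> \<bar>r1 - r2\<bar>"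
        using lip[OF inv(1)[OF r(1)] inv(1)[OF r(2)], of i i i]
          \<kappa>(2)[OF inv(1)[OF r(1)] inv(1)[OF r(2)], of i i i] r by (simp_all add: inv(2))
      thus "1 / L' * \<bar>r1 - r2\<bar> \<le> ?d" "?d \<le> 1 / \<kappa> * \<bar>r1 - r2\<bar>"
        using L'(1) \<kappa>(1) by (simp_all add: pos_divide_le_eq pos_le_divide_eq mult.commute)
    qed
  qed

  \<comment> \<open>The identity serves as \<open>\<sigma>min\<close>, because fixed points of the
    operator truncated at \<open>r\<close> are at least \<open>r\<close>; the MBI function \<phi>
    serves as \<open>\<sigma>max\<close>.\<close>
  have id: "(\<lambda>r. r) \<in> class_K_inf"
  proof -
    have "\<not> bdd_above {0 :: real..}"
    proof
      assume "bdd_above {0 :: real..}"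
      then obtain M where M: "\<And>r. 0 \<le> r \<Longrightarrow> r \<le> (M :: real)" by (auto simp: bdd_above_def)
      show False using M[of "max M 0 + 1"] by simp
    qed
    thus ?thesis
      by (simp add: class_K_inf_def class_K_def monotone_on_def)
  qed
  have decay: "?\<Gamma> (\<sigma> r) \<preceq> \<sigma> r" if "0 \<le> r" for r
    unfolding seq_le_def using fp[OF that] by (metis max.cobounded2)
  have pos: "\<sigma> r \<in> ell_inf_pos" if "0 \<le> r" for r
    using selection that Fix_trunc_op(1) by blast
  show ?thesis
    unfolding path_of_decay_def
  proof (intro conjI)
    show "\<exists>\<sigma>min\<in>class_K_inf. \<exists>\<sigma>max\<in>class_K_inf. \<forall>i. \<forall>r\<ge>0. \<sigma>min r \<le> \<sigma> r i \<and> \<sigma> r i \<le> \<sigma>max r"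
      using ge le by (intro bexI[OF _ id] bexI[OF _ \<phi>]) simp
    show "\<forall>a b. 0 < a \<and> a \<le> b \<longrightarrow> (\<exists>c C. 0 < c \<and> c \<le> C \<and> (\<forall>i. \<forall>r1\<in>{a..b}. \<forall>r2\<in>{a..b}.
        c * \<bar>r1 - r2\<bar> \<le> \<bar>inv_pos (\<lambda>r. \<sigma> r i) r1 - inv_pos (\<lambda>r. \<sigma> r i) r2\<bar> \<and>
        \<bar>inv_pos (\<lambda>r. \<sigma> r i) r1 - inv_pos (\<lambda>r. \<sigma> r i) r2\<bar> \<le> C * \<bar>r1 - r2\<bar>))"
      by (intro allI impI, elim conjE, rule inverse)
  qed (simp_all add: pos decay K)
qed

end
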